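(* Let $\Omega_1,\dots,\Omega_N\subset\mathbb{R}^d$, the constants $\boldsymbol{\alpha}=(\alpha_1,\dots,\alpha_N)$, the boundary functions $\beta_1,\dots,\beta_N$, the function $\Phi$ and the integral operators $\mathcal{K}^*_{i,j}$ be as defined in the context. Fix a query point $\boldsymbol{x}\in\Omega$ and an integer $i\ge0$. Let $H_0,H_1,\dots,H_i$ be independent random variables with values in $\{1,\dots,N\}$ and distributions, for $n\in\{1,\dots,N\}$, $$\mathbb{P}(H_0=n)=\frac1N,\qquad \mathbb{P}(H_m=n)=\frac{|\alpha_n|}{\|\boldsymbol{\alpha}\|_1}\quad(1\le m\le i),$$ where $\|\cdot\|_1$ is the $\ell_1$ norm. Then $$\sum_{h_i,\dots,h_1,h_0=1}^{N}\int_{\partial\Omega_{h_i}}\Phi(\boldsymbol{x},\boldsymbol{y})\Bigl((\alpha_{h_i}\mathcal{K}^*_{h_i,h_{i-1}})\cdots(\alpha_{h_2}\mathcal{K}^*_{h_2,h_1})(\alpha_{h_1}\mathcal{K}^*_{h_1,h_0})\beta_{h_0}\Bigr)(\boldsymbol{y})\,dA_{\boldsymbol{y}}$$ $$=N\,\|\boldsymbol{\alpha}\|_1^{\,i}\;\mathbb{E}_{H_i,\dots,H_0}\left[\prod_{m=1}^{i}\operatorname{sign}(\alpha_{H_m})\int_{\partial\Omega_{H_i}}\Phi(\boldsymbol{x},\boldsymbol{y})\bigl(\mathcal{K}^*_{H_i,H_{i-1}}\cdots\mathcal{K}^*_{H_1,H_0}\beta_{H_0}\bigr)(\boldsymbol{y})\,dA_{\boldsymbol{y}}\right]$$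 (for $i=0$ the products of operators and of signs are empty).
   Context: Let $d\ge 2$ and let $\Omega=\Omega_1\subset\mathbb{R}^d$ be a bounded, simply connected domain. Let $\Omega_1,\dots,\Omega_N$ be regions contained in $\Omega$ organized as a rooted tree with root $\Omega_1$: each $\Omega_i$ denotes the $i$-th region together with all its descendants, and each $i\ge 2$ has a unique parent index $\mathrm{pa}(i)$, with $\Omega_i\subset\Omega_{\mathrm{pa}(i)}$. The boundaries $\partial\Omega_1,\dots,\partial\Omega_N$ are of class $C^2$ and pairwise disjoint; $\boldsymbol{n}(\boldsymbol{x})$ is the unit normal at $\boldsymbol{x}\in\partial\Omega_i$ pointing out of $\Omega_i$, and $dA$ is surface measure. Let $\sigma_1,\dots,\sigma_N\ge0$ be constants with $\sigma_1>0$ and $\sigma_{\mathrm{pa}(i)}+\sigma_i>0$ for $i\ge2$, and let $b_i:\partial\Omega_i\to\mathbb{R}$ be Lipschitz with $\int_{\partial\Omega_i}b_i\,dA=0$. Define $$\alpha_1=2,\quad \alpha_i=\frac{2(\sigma_i-\sigma_{\mathrm{pa}(i)})}{\sigma_{\mathrm{pa}(i)}+\sigma_i}\ (i\ge2),\qquad \beta_1=\frac{2}{\sigma_1}b_1,\quad \beta_i=-\frac{2}{\sigma_{\mathrm{pa}(i)}+\sigma_i}b_i\ (i\ge2).$$ Let $\omega_d=\pi^{d/2}/\Gamma(d/2+1)$ be the volume of the unit ball of $\mathbb{R}^d$ and $$\Phi(\boldsymbol{x},\boldsymbol{y})=\begin{cases}-\frac{1}{2\pi}\ln|\boldsymbol{x}-\boldsymbol{y}|,&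 d=2,\\ \frac{1}{d(d-2)\omega_d}\,|\boldsymbol{x}-\boldsymbol{y}|^{2-d},& d\ge3.\end{cases}$$ For $\boldsymbol{x}\in\partial\Omega_i$, $\boldsymbol{y}\in\partial\Omega_j$, $\boldsymbol{x}\ne\boldsymbol{y}$, set $$K^*_{i,j}(\boldsymbol{x},\boldsymbol{y})=-\frac{\partial\Phi(\boldsymbol{x},\boldsymbol{y})}{\partial\boldsymbol{n}(\boldsymbol{x})}=\frac{1}{d\,\omega_d}\,\frac{(\boldsymbol{x}-\boldsymbol{y})\cdot\boldsymbol{n}(\boldsymbol{x})}{|\boldsymbol{x}-\boldsymbol{y}|^d},$$ and define the integral operator $$(\mathcal{K}^*_{i,j}f)(\boldsymbol{x})=\int_{\partial\Omega_j}K^*_{i,j}(\boldsymbol{x},\boldsymbol{y})f(\boldsymbol{y})\,dA_{\boldsymbol{y}},\qquad \boldsymbol{x}\in\partial\Omega_i .$$ Here $\operatorname{sign}(t)$ is $1$, $0$, $-1$ according as $t>0$, $t=0$, $t<0$. *)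

theory Defs
  imports "HOL-Probability.Probability"
begin

section \<open>Surface measure\<close>

text \<open>
  Surface measure on hypersurfaces is the Hausdorff measure of codimension one, with the
  normalisation by \<^const>\<open>unit_ball_vol\<close> under which it is the classical surface area on
  $C^1$ hypersurfaces.
\<close>

definition hausdorff_pre :: "nat \<Rightarrow> real \<Rightarrow> 'a::metric_space set \<Rightarrow> ennreal" where
  "hausdorff_pre k \<delta> A =
     (INF C \<in> {C :: nat \<Rightarrow> 'a set. (\<forall>n. bounded (C n) \<and> diameter (C n) \<le> \<delta>) \<and> A \<subseteq> (\<Union>n. C n)}.
        \<Sum>n. ennreal (unit_ball_vol (real k) * (diameter (C n) / 2) ^ k))"

definition hausdorff :: "nat \<Rightarrow> 'a::metric_space set \<Rightarrow> ennreal" where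
  "hausdorff k A = (SUP \<delta>\<in>{0<..}. hausdorff_pre k \<delta> A)"

text \<open>
  \<open>measure_of\<close> returns the zero measure unless the given set function is a measure; lemma
  \<open>emeasure_surface_measure\<close> below shows that this does not happen here.
\<close>

definition surface_measure :: "'a::euclidean_space measure" where
  "surface_measure = measure_of UNIV (sets borel) (hausdorff (DIM('a) - 1))"

lemma hausdorff_pre_mono: "A \<subseteq> B \<Longrightarrow> hausdorff_pre k \<delta> A \<le> hausdorff_pre k \<delta> B"
  unfolding hausdorff_pre_def by (rule INF_superset_mono) auto

lemma hausdorff_pre_antimono: "\<delta> \<le> \<delta>' \<Longrightarrow> hausdorff_pre k \<delta>' A \<le> hausdorff_pre k \<delta> A"
  unfolding hausdorff_pre_def by (rule INF_superset_mono) (auto intro: order_trans)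

lemma hausdorff_pre_le: "0 < \<delta> \<Longrightarrow> hausdorff_pre k \<delta> A \<le> hausdorff k A"
  unfolding hausdorff_def by (rule SUP_upper) auto

lemma hausdorff_mono: "A \<subseteq> B \<Longrightarrow> hausdorff k A \<le> hausdorff k B"
  unfolding hausdorff_def by (rule SUP_mono) (auto intro: hausdorff_pre_mono)

lemma hausdorff_pre_UN:
  fixes A :: "nat \<Rightarrow> 'a::metric_space set"
  shows "hausdorff_pre k \<delta> (\<Union>n. A n) \<le> (\<Sum>n. hausdorff_pre k \<delta> (A n))"
proof (rule ennreal_le_epsilon)
  fix e :: real
  assume fin: "(\<Sum>n. hausdorff_pre k \<delta> (A n)) < top" and e: "0 < e"
  let ?w = "\<lambda>S::'a set. ennreal (unit_ball_vol (real k) * (diameter S / 2) ^ k)"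
  have "\<exists>C. (\<forall>m. bounded (C m) \<and> diameter (C m) \<le> \<delta>) \<and> A n \<subseteq> (\<Union>m. C m) \<and>
          (\<Sum>m. ?w (C m)) \<le> hausdorff_pre k \<delta> (A n) + ennreal (e * (1/2) ^ Suc n)" for n
  proof -
    have "hausdorff_pre k \<delta> (A n) < top"
      using fin by (metis ennreal_suminf_lessD)
    then have "hausdorff_pre k \<delta> (A n) < hausdorff_pre k \<delta> (A n) + ennreal (e * (1/2) ^ Suc n)"
      using e ennreal_add_left_cancel_less[of "hausdorff_pre k \<delta> (A n)" 0 "ennreal (e * (1/2) ^ Suc n)"]
      by (simp add: less_top)
    then obtain C where "\<forall>m. bounded (C m) \<and> diameter (C m) \<le> \<delta>" "A n \<subseteq> (\<Union>m. C m)"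
      "(\<Sum>m. ?w (C m)) < hausdorff_pre k \<delta> (A n) + ennreal (e * (1/2) ^ Suc n)"
      by (subst (asm) (1) hausdorff_pre_def) (auto simp: INF_less_iff)
    then show ?thesis by (intro exI[of _ C]) auto
  qed
  then obtain C where C: "\<And>n m. bounded (C n m)" "\<And>n m. diameter (C n m) \<le> \<delta>"
    "\<And>n. A n \<subseteq> (\<Union>m. C n m)"
    "\<And>n. (\<Sum>m. ?w (C n m)) \<le> hausdorff_pre k \<delta> (A n) + ennreal (e * (1/2) ^ Suc n)"
    by metis
  let ?D = "\<lambda>p. case_prod C (prod_decode p)"
  have cover: "(\<Union>n. A n) \<subseteq> (\<Union>p. ?D p)"
  proof
    fix x assume "x \<in> (\<Union>n. A n)"
    then obtain n m where "x \<in> C n m" using C(3) by blast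
    then show "x \<in> (\<Union>p. ?D p)" by (intro UN_I[of "prod_encode (n, m)"]) auto
  qed
  have "hausdorff_pre k \<delta> (\<Union>n. A n) \<le> (\<Sum>p. ?w (?D p))"
    unfolding hausdorff_pre_def using C(1,2) cover
    by (intro INF_lower) (auto simp: split_beta)
  also have "\<dots> = (\<Sum>n. \<Sum>m. ?w (C n m))"
    using suminf_ennreal_2dimen[of "\<lambda>n. \<Sum>m. ?w (C n m)" "\<lambda>q. ?w (case_prod C q)"] by simp
  also have "\<dots> \<le> (\<Sum>n. hausdorff_pre k \<delta> (A n) + ennreal (e * (1/2) ^ Suc n))"
    by (intro suminf_le C(4) summableI)
  also have "\<dots> = (\<Sum>n. hausdorff_pre k \<delta> (A n)) + (\<Sum>n. ennreal (e * (1/2) ^ Suc n))"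
    by (rule suminf_add[symmetric]) (auto intro: summableI)
  also have "(\<Sum>n. ennreal (e * (1/2) ^ Suc n)) = ennreal e"
    using sums_mult[OF power_half_series, of e] e
    by (subst suminf_ennreal2) (auto simp: sums_iff)
  finally show "hausdorff_pre k \<delta> (\<Union>n. A n) \<le> (\<Sum>n. hausdorff_pre k \<delta> (A n)) + ennreal e" .
qed

lemma hausdorff_UN: "hausdorff k (\<Union>n. A n) \<le> (\<Sum>n. hausdorff k (A n))"
proof -
  have "hausdorff_pre k \<delta> (\<Union>n. A n) \<le> (\<Sum>n. hausdorff k (A n))" if "0 < \<delta>" for \<delta>
    using hausdorff_pre_UN by (rule order_trans) (intro suminf_le hausdorff_pre_le that summableI)
  then show ?thesis by (subst hausdorff_def) (auto intro: SUP_least)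
qed

lemma hausdorff_empty:
  assumes "k > 0"
  shows "hausdorff k {} = 0"
proof -
  have "hausdorff_pre k \<delta> ({} :: 'a set) \<le> 0" if "0 < \<delta>" for \<delta>
    unfolding hausdorff_pre_def using assms that
    by (intro INF_lower2[of "\<lambda>_. {}"]) (auto simp: diameter_empty power_0_left)
  then have "hausdorff k ({} :: 'a set) \<le> 0" unfolding hausdorff_def by (intro SUP_least) auto
  then show ?thesis by simp
qed

lemma hausdorff_Un:
  fixes A B :: "'a::metric_space set"
  assumes "k > 0"
  shows "hausdorff k (A \<union> B) \<le> hausdorff k A + hausdorff k B"
proof -
  have "hausdorff k (\<Union>n. binaryset A B n) \<le> (\<Sum>n. hausdorff k (binaryset A B n))"
    by (rule hausdorff_UN)
  then show ?thesis
    using suminf_binaryset_eq[of "hausdorff k" A B] hausdorff_empty[OF assms, where 'a = 'a]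
    by (simp add: UN_binaryset_eq)
qed

lemma hausdorff_separated:
  fixes A B :: "'a::metric_space set"
  assumes k: "k > 0" and e: "0 < e" and sep: "\<And>x y. x \<in> A \<Longrightarrow> y \<in> B \<Longrightarrow> e \<le> dist x y"
  shows "hausdorff k A + hausdorff k B \<le> hausdorff k (A \<union> B)"
proof -
  let ?w = "\<lambda>S::'a set. ennreal (unit_ball_vol (real k) * (diameter S / 2) ^ k)"
  have small: "hausdorff_pre k \<delta> A + hausdorff_pre k \<delta> B \<le> hausdorff_pre k \<delta> (A \<union> B)"
    if \<delta>: "0 < \<delta>" "\<delta> < e" for \<delta>
  proof (subst (3) hausdorff_pre_def, rule INF_greatest)
    fix C :: "nat \<Rightarrow> 'a set"
    assume "C \<in> {C. (\<forall>n. bounded (C n) \<and> diameter (C n) \<le> \<delta>) \<and> A \<union> B \<subseteq> (\<Union>n. C n)}"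
    then have C: "\<And>n. bounded (C n)" "\<And>n. diameter (C n) \<le> \<delta>" "A \<union> B \<subseteq> (\<Union>n. C n)" by auto
    define CA where "CA n = (if C n \<inter> A = {} then {} else C n)" for n
    define CB where "CB n = (if C n \<inter> B = {} then {} else C n)" for n
    have excl: "C n \<inter> A = {} \<or> C n \<inter> B = {}" for n
    proof (rule ccontr)
      assume "\<not> ?thesis"
      then obtain x y where "x \<in> C n" "x \<in> A" "y \<in> C n" "y \<in> B" by auto
      then show False
        using diameter_bounded_bound[OF C(1), of x n y] C(2)[of n] sep[of x y] \<delta> by auto
    qed
    have "A \<subseteq> (\<Union>n. CA n)" "B \<subseteq> (\<Union>n. CB n)"
      using C(3) unfolding CA_def CB_def by (fastforce split: if_splits)+
    then have "hausdorff_pre k \<delta> A \<le> (\<Sum>n. ?w (CA n))" "hausdorff_pre k \<delta> B \<le> (\<Sum>n. ?w (CB n))"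
      unfolding hausdorff_pre_def using C(1,2) \<delta>
      by (intro INF_lower; simp add: CA_def CB_def diameter_empty del: UN_simps)+
    then have "hausdorff_pre k \<delta> A + hausdorff_pre k \<delta> B \<le> (\<Sum>n. ?w (CA n)) + (\<Sum>n. ?w (CB n))"
      by (rule add_mono)
    also have "\<dots> = (\<Sum>n. ?w (CA n) + ?w (CB n))" by (rule suminf_add) (auto intro: summableI)
    also have "\<dots> \<le> (\<Sum>n. ?w (C n))"
    proof (intro suminf_le summableI)
      fix n show "?w (CA n) + ?w (CB n) \<le> ?w (C n)"
        using excl[of n] k by (auto simp: CA_def CB_def diameter_empty power_0_left)
    qed
    finally show "hausdorff_pre k \<delta> A + hausdorff_pre k \<delta> B \<le> (\<Sum>n. ?w (C n))" .
  qed
  have "hausdorff k A + hausdorff k B = (SUP \<delta>\<in>{0<..}. hausdorff_pre k \<delta> A + hausdorff_pre k \<delta> B)"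
    unfolding hausdorff_def
  proof (rule SUP_add_directed_ennreal[symmetric])
    fix i j :: real assume "i \<in> {0<..}" "j \<in> {0<..}"
    then show "\<exists>l\<in>{0<..}. hausdorff_pre k i A + hausdorff_pre k j B
        \<le> hausdorff_pre k l A + hausdorff_pre k l B"
      by (intro bexI[of _ "min i j"] add_mono hausdorff_pre_antimono) auto
  qed
  also have "\<dots> \<le> hausdorff k (A \<union> B)"
  proof (rule SUP_least)
    fix \<delta> :: real assume "\<delta> \<in> {0<..}"
    define \<delta>' where "\<delta>' = min \<delta> (e / 2)"
    have \<delta>': "0 < \<delta>'" "\<delta>' < e" "\<delta>' \<le> \<delta>" using \<open>\<delta> \<in> {0<..}\<close> e by (auto simp: \<delta>'_def)
    have "hausdorff_pre k \<delta> A + hausdorff_pre k \<delta> B \<le> hausdorff_pre k \<delta>' A + hausdorff_pre k \<delta>' B"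
      by (intro add_mono hausdorff_pre_antimono \<delta>')
    also have "\<dots> \<le> hausdorff_pre k \<delta>' (A \<union> B)" by (intro small \<delta>')
    also have "\<dots> \<le> hausdorff k (A \<union> B)" by (intro hausdorff_pre_le \<delta>')
    finally show "hausdorff_pre k \<delta> A + hausdorff_pre k \<delta> B \<le> hausdorff k (A \<union> B)" .
  qed
  finally show ?thesis .
qed

lemma hausdorff_finite_UN:
  fixes R :: "nat \<Rightarrow> 'a::metric_space set"
  assumes k: "k > 0"
    and sep: "\<And>i j. i < j \<Longrightarrow> \<exists>e>0. \<forall>x\<in>R i. \<forall>y\<in>R j. e \<le> dist x y"
  shows "(\<Sum>i<n. hausdorff k (R i)) \<le> hausdorff k (\<Union>i<n. R i)"
proof (induction n)
  case 0
  show ?case by simp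
next
  case (Suc n)
  obtain f where f: "\<And>i. i < n \<Longrightarrow> 0 < f i \<and> (\<forall>x\<in>R i. \<forall>y\<in>R n. f i \<le> dist x y)"
    using sep[of _ n] by metis
  define e where "e = Min (insert 1 (f ` {..<n}))"
  have e: "0 < e" "\<And>i. i < n \<Longrightarrow> e \<le> f i" using f by (auto simp: e_def)
  have "(\<Sum>i<Suc n. hausdorff k (R i)) \<le> hausdorff k (\<Union>i<n. R i) + hausdorff k (R n)"
    using Suc by (simp add: add_mono)
  also have "\<dots> \<le> hausdorff k ((\<Union>i<n. R i) \<union> R n)"
    by (rule hausdorff_separated[OF k e(1)]) (use f e(2) in \<open>force intro: order_trans\<close>)
  also have "(\<Union>i<n. R i) \<union> R n = (\<Union>i<Suc n. R i)" by (auto simp: less_Suc_eq)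
  finally show ?case .
qed

lemma hausdorff_caratheodory:
  fixes F A :: "'a::metric_space set"
  assumes k: "k > 0" and F: "closed F"
  shows "hausdorff k (A \<inter> F) + hausdorff k (A - F) = hausdorff k A"
proof (rule antisym)
  have "hausdorff k ((A \<inter> F) \<union> (A - F)) \<le> hausdorff k (A \<inter> F) + hausdorff k (A - F)"
    by (rule hausdorff_Un[OF k])
  then show "hausdorff k A \<le> hausdorff k (A \<inter> F) + hausdorff k (A - F)" by (simp add: Int_Diff_Un)
next
  show "hausdorff k (A \<inter> F) + hausdorff k (A - F) \<le> hausdorff k A"
  proof (cases "hausdorff k A = top \<or> F = {}")
    case True
    then show ?thesis using hausdorff_empty[OF k] by auto
  next
    case False
    then have fin: "hausdorff k A < top" and ne: "F \<noteq> {}" by (auto simp: less_top)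
    define S where "S n = {x \<in> A. 1 / real (Suc n) \<le> infdist x F}" for n
    define R where "R n = {x \<in> A. 1 / real (Suc (Suc n)) \<le> infdist x F \<and> infdist x F < 1 / real (Suc n)}" for n
    have sepR: "\<exists>e>0. \<forall>x\<in>R i. \<forall>y\<in>R j. e \<le> dist x y" if "Suc i < j" for i j
    proof (intro exI conjI ballI)
      show "0 < 1 / real (Suc (Suc i)) - 1 / real (Suc j)"
        using that frac_less2[of 1 1 "real (Suc (Suc i))" "real (Suc j)"] by simp
      fix x y assume "x \<in> R i" "y \<in> R j"
      moreover have "infdist x F \<le> infdist y F + dist x y" by (rule infdist_triangle)
      ultimately show "1 / real (Suc (Suc i)) - 1 / real (Suc j) \<le> dist x y"
        by (auto simp: R_def)
    qed
    have part: "(\<Sum>n. hausdorff k (R (2 * n + c))) \<le> hausdorff k A" for c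
    proof (rule suminf_le_const[OF summableI])
      fix n
      have "(\<Sum>i<n. hausdorff k (R (2 * i + c))) \<le> hausdorff k (\<Union>i<n. R (2 * i + c))"
        by (rule hausdorff_finite_UN[OF k]) (rule sepR, simp)
      also have "\<dots> \<le> hausdorff k A" by (rule hausdorff_mono) (auto simp: R_def)
      finally show "(\<Sum>i<n. hausdorff k (R (2 * i + c))) \<le> hausdorff k A" .
    qed
    have "(\<Sum>n. hausdorff k (R n)) \<le> hausdorff k A + hausdorff k A"
    proof (rule suminf_le_const[OF summableI])
      fix n
      have "(\<Sum>i<n. hausdorff k (R i)) \<le> (\<Sum>i<2*n. hausdorff k (R i))"
        by (rule sum_mono2) auto
      also have "\<dots> = (\<Sum>i<n. hausdorff k (R (2 * i + 0))) + (\<Sum>i<n. hausdorff k (R (2 * i + 1)))"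
        by (induction n) (auto simp: algebra_simps)
      also have "\<dots> \<le> (\<Sum>i. hausdorff k (R (2 * i + 0))) + (\<Sum>i. hausdorff k (R (2 * i + 1)))"
        by (intro add_mono sum_le_suminf summableI) auto
      also have "\<dots> \<le> hausdorff k A + hausdorff k A" by (intro add_mono part)
      finally show "(\<Sum>i<n. hausdorff k (R i)) \<le> hausdorff k A + hausdorff k A" .
    qed
    then have finR: "(\<Sum>n. hausdorff k (R n)) \<noteq> top" using fin by (auto simp: top_unique)
    have tail: "(\<lambda>n. \<Sum>i. hausdorff k (R (i + n))) \<longlonglongrightarrow> 0"
    proof -
      have finRn: "hausdorff k (R n) \<noteq> top" for n
        using finR ennreal_suminf_lessD[of "\<lambda>n. hausdorff k (R n)" top n] by (auto simp: less_top)
      define r where "r n = enn2real (hausdorff k (R n))" for n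
      have r: "hausdorff k (R n) = ennreal (r n)" "0 \<le> r n" for n
        using finRn[of n] by (auto simp: r_def less_top)
      have sr: "summable r"
        using finR r by (intro summable_suminf_not_top) auto
      have "(\<lambda>n. \<Sum>i. r (i + n)) \<longlonglongrightarrow> 0" by (rule suminf_exist_split2[OF sr])
      then have "(\<lambda>n. ennreal (\<Sum>i. r (i + n))) \<longlonglongrightarrow> ennreal 0" by (rule tendsto_ennrealI)
      moreover have "ennreal (\<Sum>i. r (i + n)) = (\<Sum>i. hausdorff k (R (i + n)))" for n
        using r sr by (simp add: suminf_ennreal2 summable_ignore_initial_segment)
      ultimately show ?thesis by simp
    qed
    have main: "hausdorff k (A \<inter> F) + hausdorff k (A - F)
        \<le> hausdorff k A + (\<Sum>i. hausdorff k (R (i + n)))" for n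
    proof -
      have sub: "A - F \<subseteq> S n \<union> (\<Union>i. R (i + n))"
      proof
        fix x assume x: "x \<in> A - F"
        then have pos: "0 < infdist x F"
          using infdist_pos_not_in_closed[OF F ne] by auto
        show "x \<in> S n \<union> (\<Union>i. R (i + n))"
        proof (cases "x \<in> S n")
          case False
          then have lt: "infdist x F < 1 / real (Suc n)" using x by (auto simp: S_def)
          define m where "m = (LEAST m. 1 / real (Suc m) \<le> infdist x F)"
          obtain m0 where "1 / real (Suc m0) \<le> infdist x F"
            using pos by (metis nat_approx_posE less_imp_le)
          then have m: "1 / real (Suc m) \<le> infdist x F" unfolding m_def by (rule LeastI)
          have "n < m"
          proof (rule ccontr)
            assume "\<not> n < m"
            then have "1 / real (Suc n) \<le> 1 / real (Suc m)" by (simp add: field_simps)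
            then show False using m lt by linarith
          qed
          then obtain l where l: "m = Suc (l + n)" by (metis add.commute less_imp_Suc_add)
          have "\<not> 1 / real (Suc (l + n)) \<le> infdist x F"
            using not_less_Least[of "l + n" "\<lambda>m. 1 / real (Suc m) \<le> infdist x F"] l
            by (simp add: m_def)
          then have "x \<in> R (l + n)" using m l x by (auto simp: R_def)
          then show ?thesis by auto
        qed auto
      qed
      have "hausdorff k (A - F) \<le> hausdorff k (S n \<union> (\<Union>i. R (i + n)))" by (rule hausdorff_mono[OF sub])
      also have "\<dots> \<le> hausdorff k (S n) + hausdorff k (\<Union>i. R (i + n))" by (rule hausdorff_Un[OF k])
      also have "\<dots> \<le> hausdorff k (S n) + (\<Sum>i. hausdorff k (R (i + n)))"
        by (intro add_mono hausdorff_UN order_refl)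
      finally have 1: "hausdorff k (A - F) \<le> hausdorff k (S n) + (\<Sum>i. hausdorff k (R (i + n)))" .
      have "hausdorff k (A \<inter> F) + hausdorff k (S n) \<le> hausdorff k ((A \<inter> F) \<union> S n)"
      proof (rule hausdorff_separated[OF k])
        show "0 < 1 / real (Suc n)" by simp
        fix x y assume "x \<in> A \<inter> F" "y \<in> S n"
        then show "1 / real (Suc n) \<le> dist x y"
          using infdist_le[of x F y] by (auto simp: S_def dist_commute)
      qed
      also have "\<dots> \<le> hausdorff k A" by (rule hausdorff_mono) (auto simp: S_def)
      finally have 2: "hausdorff k (A \<inter> F) + hausdorff k (S n) \<le> hausdorff k A" .
      have "hausdorff k (A \<inter> F) + hausdorff k (A - F)
          \<le> (hausdorff k (A \<inter> F) + hausdorff k (S n)) + (\<Sum>i. hausdorff k (R (i + n)))"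
        using add_left_mono[OF 1, of "hausdorff k (A \<inter> F)"] by (simp add: add.assoc)
      also have "\<dots> \<le> hausdorff k A + (\<Sum>i. hausdorff k (R (i + n)))"
        by (rule add_right_mono[OF 2])
      finally show ?thesis .
    qed
    have "(\<lambda>n. hausdorff k A + (\<Sum>i. hausdorff k (R (i + n)))) \<longlonglongrightarrow> hausdorff k A + 0"
      by (intro tendsto_add tendsto_const tail)
    then show ?thesis
      using main by (intro LIMSEQ_le_const) auto
  qed
qed

lemma measure_space_hausdorff:
  assumes k: "k > 0"
  shows "measure_space UNIV (sets (borel :: 'a::metric_space measure)) (hausdorff k)"
proof -
  let ?L = "lambda_system UNIV (Pow UNIV) (hausdorff k) :: 'a set set"
  have "outer_measure_space (Pow (UNIV :: 'a set)) (hausdorff k)"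
    using hausdorff_empty[OF k] hausdorff_mono hausdorff_UN
    by (auto simp: outer_measure_space_def positive_def increasing_def countably_subadditive_def)
  then have L: "measure_space UNIV ?L (hausdorff k)"
    by (rule sigma_algebra.caratheodory_lemma[OF sigma_algebra_Pow])
  have "F \<in> ?L" if "closed F" for F
    using hausdorff_caratheodory[OF k that]
    by (simp only: algebra.lambda_system_eq[OF algebra_Pow]) simp
  then have "sigma_sets UNIV (Collect closed) \<subseteq> ?L"
    using L by (intro sigma_algebra.sigma_sets_subset) (auto simp: measure_space_def)
  then have "sets (borel :: 'a measure) \<subseteq> ?L"
    by (simp add: borel_eq_closed sets_measure_of)
  then show ?thesis
    by (rule measure_down[OF L, rotated]) (metis sets.sigma_algebra_axioms space_borel)
qed

lemma sets_surface_measure [simp, measurable_cong]: "sets surface_measure = sets borel"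
  unfolding surface_measure_def by (metis sets.sigma_sets_eq sets_measure_of_conv space_borel subset_UNIV Pow_UNIV)

lemma space_surface_measure [simp]: "space surface_measure = UNIV"
  by (simp add: surface_measure_def space_measure_of_conv)

lemma emeasure_surface_measure:
  fixes A :: "'a::euclidean_space set"
  assumes "DIM('a) \<ge> 2" "A \<in> sets borel"
  shows "emeasure surface_measure A = hausdorff (DIM('a) - 1) A"
proof (rule emeasure_measure_of[OF surface_measure_def])
  have "measure_space UNIV (sets (borel :: 'a measure)) (hausdorff (DIM('a) - 1))"
    using assms(1) by (intro measure_space_hausdorff) auto
  then show "positive (sets (surface_measure :: 'a measure)) (hausdorff (DIM('a) - 1))"
    "countably_additive (sets (surface_measure :: 'a measure)) (hausdorff (DIM('a) - 1))"
    by (auto simp: measure_space_def)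
qed (use assms in auto)

section \<open>Boundaries of class \<open>C\<^sup>2\<close> and the outward normal\<close>

definition C2_fun :: "('a::real_normed_vector \<Rightarrow> real) \<Rightarrow> bool" where
  "C2_fun f \<longleftrightarrow>
     (\<exists>(f' :: 'a \<Rightarrow> 'a \<Rightarrow>\<^sub>L real) (f'' :: 'a \<Rightarrow> 'a \<Rightarrow>\<^sub>L 'a \<Rightarrow>\<^sub>L real).
        (\<forall>x. (f has_derivative blinfun_apply (f' x)) (at x)) \<and>
        (\<forall>x. (f' has_derivative blinfun_apply (f'' x)) (at x)) \<and>
        continuous_on UNIV f'')"

text \<open>
  Near each boundary point the open set is, after choosing an axis \<open>e\<close>, the strict epigraph of
  a $C^2$ function of the remaining $d-1$ coordinates. The function \<open>g\<close> is defined on the whole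
  space, but only its values on the hyperplane orthogonal to \<open>e\<close> are used.
\<close>

definition C2_boundary :: "'a::euclidean_space set \<Rightarrow> bool" where
  "C2_boundary \<Omega> \<longleftrightarrow>
     (\<forall>p\<in>frontier \<Omega>. \<exists>r e g. 0 < r \<and> norm e = 1 \<and> C2_fun g \<and>
        \<Omega> \<inter> ball p r = {x \<in> ball p r. g (x - (x \<bullet> e) *\<^sub>R e) < x \<bullet> e})"

definition tangent_vector :: "'a::real_normed_vector set \<Rightarrow> 'a \<Rightarrow> 'a \<Rightarrow> bool" where
  "tangent_vector S x u \<longleftrightarrow>
     (\<exists>c \<epsilon>. 0 < \<epsilon> \<and> c 0 = x \<and> (\<forall>t. \<bar>t\<bar> < \<epsilon> \<longrightarrow> c t \<in> S) \<and> (c has_vector_derivative u) (at (0::real)))"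

definition outward_unit_normal :: "'a::euclidean_space set \<Rightarrow> 'a \<Rightarrow> 'a \<Rightarrow> bool" where
  "outward_unit_normal \<Omega> x v \<longleftrightarrow>
     norm v = 1 \<and>
     (\<forall>u. tangent_vector (frontier \<Omega>) x u \<longrightarrow> u \<bullet> v = 0) \<and>
     (\<exists>\<epsilon>>0. \<forall>t. 0 < t \<and> t < \<epsilon> \<longrightarrow> x + t *\<^sub>R v \<notin> \<Omega> \<and> x - t *\<^sub>R v \<in> \<Omega>)"

section \<open>Coefficients, fundamental solution and integral operators\<close>

definition alpha :: "(nat \<Rightarrow> nat) \<Rightarrow> (nat \<Rightarrow> real) \<Rightarrow> nat \<Rightarrow> real" where
  "alpha pa \<sigma> i = (if i = 1 then 2 else 2 * (\<sigma> i - \<sigma> (pa i)) / (\<sigma> (pa i) + \<sigma> i))"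

definition beta :: "(nat \<Rightarrow> nat) \<Rightarrow> (nat \<Rightarrow> real) \<Rightarrow> (nat \<Rightarrow> 'a \<Rightarrow> real) \<Rightarrow> nat \<Rightarrow> 'a \<Rightarrow> real" where
  "beta pa \<sigma> b i y = (if i = 1 then 2 / \<sigma> 1 * b 1 y else - (2 / (\<sigma> (pa i) + \<sigma> i)) * b i y)"

definition Phi :: "'a::euclidean_space \<Rightarrow> 'a \<Rightarrow> real" where
  "Phi x y =
     (if DIM('a) = 2 then - (1 / (2 * pi)) * ln (norm (x - y))
      else 1 / (real DIM('a) * (real DIM('a) - 2) * unit_ball_vol (real DIM('a)))
             * norm (x - y) powi (2 - int DIM('a)))"

text \<open>The kernel takes the value 0 on the diagonal, a null set for surface measure.\<close>

definition Kstar_kernel :: "('a::euclidean_space \<Rightarrow> 'a) \<Rightarrow> 'a \<Rightarrow> 'a \<Rightarrow> real" where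
  "Kstar_kernel n x y =
     1 / (real DIM('a) * unit_ball_vol (real DIM('a))) * ((x - y) \<bullet> n x) / norm (x - y) ^ DIM('a)"

text \<open>This is minus the derivative of \<open>Phi\<close> along the normal at \<open>x\<close>:\<close>

lemma Kstar_kernel_eq:
  fixes x y :: "'a::euclidean_space"
  assumes d: "DIM('a) \<ge> 2" and xy: "x \<noteq> y"
  shows "((\<lambda>t. Phi (x + t *\<^sub>R n x) y) has_real_derivative - Kstar_kernel n x y) (at 0)"
proof -
  define v where "v = n x"
  define r where "r = norm (x - y)"
  have r: "r > 0" using xy by (simp add: r_def)
  let ?g = "\<lambda>t::real. norm (x + t *\<^sub>R v - y)"
  have g: "(?g has_real_derivative ((x - y) \<bullet> v) / r) (at 0)"
  proof -
    have "((\<lambda>t::real. x + t *\<^sub>R v - y) has_derivative (\<lambda>t. t *\<^sub>R v)) (at 0)"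
      by (auto intro!: derivative_eq_intros)
    moreover have "(norm has_derivative (\<lambda>h. h \<bullet> sgn (x - y))) (at (x + 0 *\<^sub>R v - y))"
      using has_derivative_norm[of "x - y"] xy by simp
    ultimately have "(?g has_derivative (\<lambda>t. (t *\<^sub>R v) \<bullet> sgn (x - y))) (at 0)"
      by (rule has_derivative_compose)
    moreover have "(\<lambda>t. (t *\<^sub>R v) \<bullet> sgn (x - y)) = (*) ((x - y) \<bullet> v / r)"
      by (simp add: fun_eq_iff sgn_div_norm r_def inner_commute divide_inverse)
    ultimately show ?thesis unfolding has_field_derivative_def by simp
  qed
  show ?thesis
  proof (cases "DIM('a) = 2")
    case True
    have "unit_ball_vol 2 = pi" by (simp add: unit_ball_vol_2)
    then show ?thesis
      unfolding Phi_def Kstar_kernel_def using True r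
      by (auto intro!: derivative_eq_intros g[unfolded v_def] simp: r_def power2_eq_square)
  next
    case False
    define d where "d = DIM('a)"
    have d3: "d \<ge> 3" using False d by (simp add: d_def)
    have w: "unit_ball_vol (real d) > 0" by simp
    have pw: "((\<lambda>t. ?g t powi (2 - int d)) has_real_derivative
        (2 - real d) * r powi (1 - int d) * (((x - y) \<bullet> v) / r)) (at 0)"
      using r by (auto intro!: derivative_eq_intros g simp: r_def)
    have "r powi (1 - int d) / r = 1 / r ^ d"
      using r by (simp add: power_int_diff)
    then have "(2 - real d) * r powi (1 - int d) * (((x - y) \<bullet> v) / r)
        = (2 - real d) * ((x - y) \<bullet> v) / r ^ d"
      by (metis (no_types, lifting) mult.assoc mult.commute times_divide_eq_right mult_1)
    with pw have "((\<lambda>t. ?g t powi (2 - int d)) has_real_derivative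
        (2 - real d) * ((x - y) \<bullet> v) / r ^ d) (at 0)"
      by (simp only:)
    note DERIV_cmult[OF this, of "1 / (real d * (real d - 2) * unit_ball_vol (real d))"]
    moreover have "1 / (real d * (real d - 2) * unit_ball_vol (real d))
        * ((2 - real d) * ((x - y) \<bullet> v) / r ^ d)
        = - (1 / (real d * unit_ball_vol (real d)) * ((x - y) \<bullet> v) / r ^ d)"
    proof -
      have "1 / (a * c * u) * (- c * s / q) = - (1 / (a * u) * s / q)" if "c \<noteq> 0" for a c u s q :: real
        using that by simp
      from this[of "real d - 2"] show ?thesis using d3 by simp
    qed
    ultimately show ?thesis
      using False by (simp add: Phi_def Kstar_kernel_def d_def v_def r_def)
  qed
qed

text \<open>
  Functions on \<open>\<partial>\<Omega>\<^sub>i\<close> are represented by functions on the whole space; the image of the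
  operator is extended by 0 outside \<open>\<partial>\<Omega>\<^sub>i\<close>.
\<close>

definition Kstar ::
  "(nat \<Rightarrow> 'a::euclidean_space set) \<Rightarrow> ('a \<Rightarrow> 'a) \<Rightarrow> nat \<Rightarrow> nat \<Rightarrow> ('a \<Rightarrow> real) \<Rightarrow> 'a \<Rightarrow> real" where
  "Kstar Om n i j f x =
     (if x \<in> frontier (Om i)
      then LINT y:frontier (Om j)|surface_measure. Kstar_kernel n x y * f y
      else 0)"

text \<open>
  \<open>op_chain T f h m\<close> is $T_{h_m,h_{m-1}} \cdots T_{h_2,h_1} T_{h_1,h_0} f_{h_0}$.
\<close>

primrec op_chain ::
  "(nat \<Rightarrow> nat \<Rightarrow> ('a \<Rightarrow> real) \<Rightarrow> 'a \<Rightarrow> real) \<Rightarrow> (nat \<Rightarrow> 'a \<Rightarrow> real) \<Rightarrow> (nat \<Rightarrow> nat) \<Rightarrow> nat \<Rightarrow> 'a \<Rightarrow> real" where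
  "op_chain T f h 0 = f (h 0)"
| "op_chain T f h (Suc m) = T (h (Suc m)) (h m) (op_chain T f h m)"

end

theory Submission
  imports Defs
begin

text \<open>
  The operators are linear and the Bochner integral commutes with scalars unconditionally, so each
  summand on the left is a product of coefficients times the integral on the right. The joint law of
  \<open>H\<close> gives that integral the weight $\frac1N\prod_m |\alpha_{h_m}|/\|\alpha\|_1$, and
  $|\alpha|\operatorname{sign}(\alpha) = \alpha$ restores the coefficients. Since
  $\alpha_1 = 2$, the normalisation is nonzero.
\<close>

text \<open>The chain of length \<open>i\<close> reads its index sequence only up to position
  \<open>i\<close>; this makes the infinite sequence \<open>\<lambda>m. H m w\<close>
  interchangeable with its restriction to \<open>{0..i}\<close>.\<close>

lemma op_chain_cong:
  assumes "\<And>m. m \<le> i \<Longrightarrow> h m = h' m"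
  shows "op_chain T f h i = op_chain T f h' i"
  using assms by (induction i) auto

text \<open>Homogeneity moves each scalar outward through all later operators. The product starts at
  \<open>m=1\<close> because a coefficient belongs to the target index of an operator, and
  \<open>h 0\<close> is only ever a source.\<close>

lemma op_chain_scale:
  assumes hom: "\<And>k j c g z. T k j (\<lambda>y. c * g y) z = c * T k j g z"
  shows "op_chain (\<lambda>k j g z. a k * T k j g z) f h i y
    = (\<Prod>m=1..i. a (h m)) * op_chain T f h i y"
proof (induction i arbitrary: y)
  case (Suc i)
  \<comment> \<open>The next operator acts on the whole function, so the pointwise hypothesis, kept
    general in \<open>y\<close>, is turned into an equality of functions.\<close>
  then have "op_chain (\<lambda>k j g z. a k * T k j g z) f h i
      = (\<lambda>y. (\<Prod>m=1..i. a (h m)) * op_chain T f h i y)"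
    by blast
  then show ?case by (simp add: hom)
qed simp

text \<open>True even where the integral diverges: for nonzero \<open>c\<close> both integrands are
  then non-integrable and both integrals take the default value 0.\<close>

lemma Kstar_mult: "Kstar Om n k j (\<lambda>y. c * g y) z = c * Kstar Om n k j g z"
proof -
  have "(\<lambda>y. Kstar_kernel n z y * (c * g y)) = (\<lambda>y. c * (Kstar_kernel n z y * g y))"
    by (simp add: mult.left_commute)
  then show ?thesis by (simp add: Kstar_def)
qed

text \<open>Finitely many joint values partition the sample space into the events
  \<open>?E h\<close>. The integrand has the constant value \<open>F h\<close> on each, and
  independence factorises its probability. Restricting to \<open>I\<close> makes the sampled tuple
  extensional, hence one of the summation indices.\<close>

lemma (in prob_space) expectation_indep_finite:
  fixes F :: "('i \<Rightarrow> 'b) \<Rightarrow> real"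
  assumes I: "finite I" and S: "finite S"
    and indep: "indep_vars (\<lambda>_. count_space S) X I"
  shows "expectation (\<lambda>w. F (restrict (\<lambda>m. X m w) I))
    = (\<Sum>h\<in>I \<rightarrow>\<^sub>E S. (\<Prod>m\<in>I. prob {w \<in> space M. X m w = h m}) * F h)"
proof -
  let ?E = "\<lambda>h. {w \<in> space M. \<forall>m\<in>I. X m w = h m}"
  have fin: "finite (I \<rightarrow>\<^sub>E S)" using I S by (intro finite_PiE) auto
  have meas: "X m \<in> M \<rightarrow>\<^sub>M count_space S" if "m \<in> I" for m
    using indep that unfolding indep_vars_def2 by auto
  have level: "{w \<in> space M. X m w = s} \<in> events" if "m \<in> I" "s \<in> S" for m s
  proof -
    have "{w \<in> space M. X m w = s} = X m -` {s} \<inter> space M" by auto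
    then show ?thesis using measurable_sets[OF meas[OF that(1)], of "{s}"] that by simp
  qed
  have E: "?E h \<in> events" if "h \<in> I \<rightarrow>\<^sub>E S" for h
    using I that by (intro sets.sets_Collect_finite_All' sets.sets_Collect_finite_All level)
      (auto simp: PiE_iff)
  have prob_E: "prob (?E h) = (\<Prod>m\<in>I. prob {w \<in> space M. X m w = h m})"
    if h: "h \<in> I \<rightarrow>\<^sub>E S" for h
  \<comment> \<open>The product rule for independent variables is stated for a nonempty index set;
    for empty \<open>I\<close> the event is the whole space.\<close>
  proof (cases "I = {}")
    case True
    then show ?thesis by (simp add: prob_space)
  next
    case False
    have "?E h = (\<Inter>m\<in>I. X m -` {h m} \<inter> space M)" using False by auto
    also have "prob \<dots> = (\<Prod>m\<in>I. prob (X m -` {h m} \<inter> space M))"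
      using h by (intro indep_varsD_finite[OF indep False I]) (auto simp: PiE_iff)
    also have "\<dots> = (\<Prod>m\<in>I. prob {w \<in> space M. X m w = h m})"
      by (intro prod.cong arg_cong[of _ _ prob]) auto
    finally show ?thesis .
  qed
  have "expectation (\<lambda>w. F (restrict (\<lambda>m. X m w) I))
      = expectation (\<lambda>w. \<Sum>h\<in>I \<rightarrow>\<^sub>E S. indicator (?E h) w * F h)"
  proof (rule Bochner_Integration.integral_cong[OF refl])
    fix w assume w: "w \<in> space M"
    let ?r = "restrict (\<lambda>m. X m w) I"
    have r: "?r \<in> I \<rightarrow>\<^sub>E S" using measurable_space[OF meas w] by auto
    have "indicator (?E h) w * F h = (if h = ?r then F h else 0)" if "h \<in> I \<rightarrow>\<^sub>E S" for h
    proof -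
      \<comment> \<open>Both tuples are extensional, so agreement on \<open>I\<close> is already
        equality.\<close>
      have iff: "w \<in> ?E h \<longleftrightarrow> h = ?r" using w PiE_ext[OF that r] by auto
      show ?thesis unfolding indicator_def iff by simp
    qed
    then have "(\<Sum>h\<in>I \<rightarrow>\<^sub>E S. indicator (?E h) w * F h)
        = (\<Sum>h\<in>I \<rightarrow>\<^sub>E S. if h = ?r then F h else 0)"
      by (rule sum.cong[OF refl])
    also have "\<dots> = F ?r" using fin r by simp
    finally show "F ?r = (\<Sum>h\<in>I \<rightarrow>\<^sub>E S. indicator (?E h) w * F h)" by simp
  qed
  \<comment> \<open>Each summand is integrable, being a multiple of the indicator of an event, so
    expectation and finite sum commute.\<close>
  also have "\<dots> = (\<Sum>h\<in>I \<rightarrow>\<^sub>E S. prob (?E h) * F h)"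
    using E by (subst Bochner_Integration.integral_sum) (auto simp: less_top[symmetric])
  also have "\<dots> = (\<Sum>h\<in>I \<rightarrow>\<^sub>E S. (\<Prod>m\<in>I. prob {w \<in> space M. X m w = h m}) * F h)"
    by (intro sum.cong) (simp_all add: prob_E)
  finally show ?thesis .
qed

theorem theorem4p2:
  fixes Om :: "nat \<Rightarrow> 'a::euclidean_space set"
    and N :: nat and pa :: "nat \<Rightarrow> nat"
    and n :: "'a \<Rightarrow> 'a"
    and \<sigma> :: "nat \<Rightarrow> real" and b :: "nat \<Rightarrow> 'a \<Rightarrow> real"
    and x :: 'a and i :: nat
    and M :: "'w measure" and H :: "nat \<Rightarrow> 'w \<Rightarrow> nat"
  defines "\<alpha> \<equiv> alpha pa \<sigma>"
    and "\<beta> \<equiv> beta pa \<sigma> b"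
    and "K \<equiv> Kstar Om n"
  assumes dim: "DIM('a) \<ge> 2"
    and N: "N \<ge> 1"
    and root: "open (Om 1)" "connected (Om 1)" "bounded (Om 1)" "simply_connected (Om 1)"
    and regions: "\<And>k. k \<in> {1..N} \<Longrightarrow> open (Om k) \<and> Om k \<noteq> {} \<and> Om k \<subseteq> Om 1"
    and parent: "\<And>k. k \<in> {2..N} \<Longrightarrow> pa k \<in> {1..N} \<and> Om k \<subseteq> Om (pa k)"
    and rooted: "\<And>k. k \<in> {1..N} \<Longrightarrow> \<exists>r. (pa ^^ r) k = 1"
    and smooth: "\<And>k. k \<in> {1..N} \<Longrightarrow> C2_boundary (Om k)"
    and disjoint: "disjoint_family_on (\<lambda>k. frontier (Om k)) {1..N}"
    and normal: "\<And>k y. k \<in> {1..N} \<Longrightarrow> y \<in> frontier (Om k) \<Longrightarrow> outward_unit_normal (Om k) y (n y)"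
    and sigma: "\<And>k. k \<in> {1..N} \<Longrightarrow> \<sigma> k \<ge> 0" "\<sigma> 1 > 0"
      "\<And>k. k \<in> {2..N} \<Longrightarrow> \<sigma> (pa k) + \<sigma> k > 0"
    and b_lipschitz: "\<And>k. k \<in> {1..N} \<Longrightarrow> \<exists>L. L-lipschitz_on (frontier (Om k)) (b k)"
    and b_mean: "\<And>k. k \<in> {1..N} \<Longrightarrow> (LINT y:frontier (Om k)|surface_measure. b k y) = 0"
    and query: "x \<in> Om 1"
    and prob: "prob_space M"
    and indep: "prob_space.indep_vars M (\<lambda>_. count_space {1..N}) H {0..i}"
    and dist_0: "\<And>k. k \<in> {1..N} \<Longrightarrow> measure M {w \<in> space M. H 0 w = k} = 1 / real N"
    and dist_m: "\<And>m k. m \<in> {1..i} \<Longrightarrow> k \<in> {1..N} \<Longrightarrow>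
      measure M {w \<in> space M. H m w = k} = \<bar>\<alpha> k\<bar> / (\<Sum>l=1..N. \<bar>\<alpha> l\<bar>)"
  shows
    "(\<Sum>h \<in> {0..i} \<rightarrow>\<^sub>E {1..N}.
        LINT y:frontier (Om (h i))|surface_measure.
          Phi x y * op_chain (\<lambda>k j f z. \<alpha> k * K k j f z) \<beta> h i y)
     = real N * (\<Sum>l=1..N. \<bar>\<alpha> l\<bar>) ^ i *
       prob_space.expectation M (\<lambda>w.
         (\<Prod>m=1..i. sgn (\<alpha> (H m w))) *
         (LINT y:frontier (Om (H i w))|surface_measure.
            Phi x y * op_chain K \<beta> (\<lambda>m. H m w) i y))"
proof -
  interpret prob_space M by (rule prob)
  define A where "A = (\<Sum>l=1..N. \<bar>\<alpha> l\<bar>)"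
  define J where "J h = (LINT y:frontier (Om (h i))|surface_measure. Phi x y * op_chain K \<beta> h i y)"
    for h
  define F where "F h = (\<Prod>m=1..i. sgn (\<alpha> (h m))) * J h" for h
  have "\<bar>\<alpha> 1\<bar> \<le> A"
    unfolding A_def using N by (intro member_le_sum) auto
  then have A: "A > 0" by (simp add: \<alpha>_def alpha_def)
  have lhs: "(LINT y:frontier (Om (h i))|surface_measure.
      Phi x y * op_chain (\<lambda>k j f z. \<alpha> k * K k j f z) \<beta> h i y) = (\<Prod>m=1..i. \<alpha> (h m)) * J h" for h
  proof -
    have "Phi x y * op_chain (\<lambda>k j f z. \<alpha> k * K k j f z) \<beta> h i y
        = (\<Prod>m=1..i. \<alpha> (h m)) * (Phi x y * op_chain K \<beta> h i y)" for y
      by (subst op_chain_scale) (simp_all add: K_def Kstar_mult)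
    then show ?thesis unfolding J_def by (simp only: set_integral_mult_right)
  qed
  have weight: "real N * A ^ i * ((\<Prod>m=0..i. prob {w \<in> space M. H m w = h m}) * F h)
      = (\<Prod>m=1..i. \<alpha> (h m)) * J h" if h: "h \<in> {0..i} \<rightarrow>\<^sub>E {1..N}" for h
  proof -
    have h': "h m \<in> {1..N}" if "m \<le> i" for m using h that by auto
    \<comment> \<open>Position 0 is split off because \<open>H 0\<close> is uniform: its factor
      cancels \<open>real N\<close>, while the other \<open>i\<close> denominators cancel
      \<open>A ^ i\<close>.\<close>
    have "(\<Prod>m=0..i. prob {w \<in> space M. H m w = h m})
        = prob {w \<in> space M. H 0 w = h 0} * (\<Prod>m=1..i. prob {w \<in> space M. H m w = h m})"
      by (simp add: prod.atLeast_Suc_atMost)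
    also have "\<dots> = 1 / real N * (\<Prod>m=1..i. \<bar>\<alpha> (h m)\<bar> / A)"
      using dist_0[OF h'[of 0]] dist_m[OF _ h'] by (simp add: A_def)
    also have "\<dots> = 1 / real N * ((\<Prod>m=1..i. \<bar>\<alpha> (h m)\<bar>) / A ^ i)"
      by (simp add: prod_dividef)
    finally have "real N * A ^ i * (\<Prod>m=0..i. prob {w \<in> space M. H m w = h m})
        = (\<Prod>m=1..i. \<bar>\<alpha> (h m)\<bar>)"
      using A N by simp
    moreover have "(\<Prod>m=1..i. \<bar>\<alpha> (h m)\<bar>) * (\<Prod>m=1..i. sgn (\<alpha> (h m))) = (\<Prod>m=1..i. \<alpha> (h m))"
      by (simp add: prod.distrib[symmetric] abs_mult_sgn)
    ultimately show ?thesis by (simp only: F_def mult.assoc[symmetric])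
  qed
  \<comment> \<open>\<open>F\<close> looks only at positions up to \<open>i\<close>, so the
    restricted tuple required by the expectation formula may replace the full sequence.\<close>
  have "F (restrict (\<lambda>m. H m w) {0..i}) = F (\<lambda>m. H m w)" for w
    unfolding F_def J_def by (simp cong: op_chain_cong)
  then have "expectation (\<lambda>w. F (\<lambda>m. H m w))
      = (\<Sum>h\<in>{0..i} \<rightarrow>\<^sub>E {1..N}. (\<Prod>m=0..i. prob {w \<in> space M. H m w = h m}) * F h)"
    using expectation_indep_finite[OF _ _ indep, of F] by simp
  then have "real N * A ^ i * expectation (\<lambda>w. F (\<lambda>m. H m w))
      = real N * A ^ i * (\<Sum>h\<in>{0..i} \<rightarrow>\<^sub>E {1..N}.
          (\<Prod>m=0..i. prob {w \<in> space M. H m w = h m}) * F h)"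
    by (rule arg_cong)
  also have "\<dots>
      = (\<Sum>h\<in>{0..i} \<rightarrow>\<^sub>E {1..N}. (\<Prod>m=1..i. \<alpha> (h m)) * J h)"
    unfolding sum_distrib_left by (intro sum.cong refl weight)
  finally show ?thesis unfolding lhs F_def J_def A_def by (rule sym)
qed

end
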